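(* Let $H$ be a rational symmetric matrix indexed by a finite set $V$, let $a\in V$, and suppose $0\in\operatorname{supp}_H(e_a)$. For any $b\in V$ with $b\ne a$, either no positive even power of $H$ has PST from $a$ to $b$, or every positive even power of $H$ has PST from $a$ to $b$. If some positive even power of $H$ has PST from $a$ to $b$, then $\lambda^2\in\mathbb Q$ for every $\lambda\in\operatorname{supp}_H(e_a)$.
   Context: For a finite set $V$ (elements are called vertices), $e_v$ denotes the standard basis vector indexed by $v\in V$. For a real symmetric matrix $H$ indexed by $V$ with spectral decomposition $H=\sum_{\lambda\in\operatorname{Spec}(H)}\lambda E_\lambda$ ($E_\lambda$ the orthogonal projection onto the $\lambda$-eigenspace), and a vector $x$, put $\operatorname{supp}_H(x)=\{\lambda\in\operatorname{Spec}(H):E_\lambda x\neq 0\}$. A rational symmetric matrix is a symmetric matrix with entries in $\mathbb Q$. A positive even power of $H$ is $H^k$ with $k$ a positive even integer. A real symmetric matrix $K$ has perfect state transfer (PST) from $a$ to $b$ if $\exp(-\mathrm i\tau K)e_a=\gamma e_b$ for some $\tau>0$ and some $\gamma\in\mathbb C$ with $|\gamma|=1$. *)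

theory Defs
  imports "HOL-Analysis.Analysis"
begin

definition symmetric_matrix :: "'a ^ 'v ^ 'v \<Rightarrow> bool" where
  "symmetric_matrix H \<longleftrightarrow> transpose H = H"

definition rational_matrix :: "real ^ 'v ^ 'v \<Rightarrow> bool" where
  "rational_matrix H \<longleftrightarrow> (\<forall>i j. H $ i $ j \<in> \<rat>)"

definition eigenspace :: "real ^ 'v ^ 'v \<Rightarrow> real \<Rightarrow> (real ^ 'v) set" where
  "eigenspace H l = {x. H *v x = l *s x}"

definition Spec :: "real ^ 'v ^ 'v \<Rightarrow> real set" where
  "Spec H = {l. \<exists>x. x \<noteq> 0 \<and> H *v x = l *s x}"

definition orth_proj :: "'a::euclidean_space set \<Rightarrow> 'a \<Rightarrow> 'a" where
  "orth_proj S x = (THE y. y \<in> S \<and> (\<forall>z\<in>S. orthogonal (x - y) z))"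

lemma orth_proj_ex1:
  fixes S :: "'a::euclidean_space set"
  assumes "subspace S"
  shows "\<exists>!y. y \<in> S \<and> (\<forall>z\<in>S. orthogonal (x - y) z)"
proof -
  have S: "span S = S"
    using assms by (simp add: span_eq_iff)
  obtain y z where "y \<in> S" "\<And>w. w \<in> S \<Longrightarrow> orthogonal z w" "x = y + z"
    using orthogonal_subspace_decomp_exists[of S x] unfolding S by metis
  then have ex: "y \<in> S \<and> (\<forall>z\<in>S. orthogonal (x - y) z)"
    by simp
  show ?thesis
  proof (rule ex1I[of _ y], rule ex)
    fix y' assume y': "y' \<in> S \<and> (\<forall>z\<in>S. orthogonal (x - y') z)"
    have d: "y' - y \<in> S"
      using assms ex y' by (simp add: subspace_diff)
    have "(x - y) \<bullet> (y' - y) = 0" "(x - y') \<bullet> (y' - y) = 0"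
      using ex y' d by (auto simp: orthogonal_def)
    then have "(y' - y) \<bullet> (y' - y) = 0"
      by (simp add: inner_diff_left)
    then show "y' = y"
      by simp
  qed
qed

lemma subspace_eigenspace: "subspace (eigenspace H l)"
  unfolding subspace_def eigenspace_def
  by (simp add: matrix_vector_right_distrib scaleR_add_right
      matrix_vector_mult_scaleR scalar_mult_eq_scaleR scaleR_left_commute)

definition eig_proj :: "real ^ 'v ^ 'v \<Rightarrow> real \<Rightarrow> real ^ 'v \<Rightarrow> real ^ 'v" where
  "eig_proj H l = orth_proj (eigenspace H l)"

definition eig_supp :: "real ^ 'v ^ 'v \<Rightarrow> real ^ 'v \<Rightarrow> real set" where
  "eig_supp H x = {l \<in> Spec H. eig_proj H l x \<noteq> 0}"

text \<open>The library's \<open>^\<close> on \<open>'a ^ 'v ^ 'v\<close> is the entrywise power, and its \<open>exp\<close> does not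
  apply to this type, so the matrix power and the matrix exponential are defined here.\<close>

primrec mat_pow :: "'a::semiring_1 ^ 'v ^ 'v \<Rightarrow> nat \<Rightarrow> 'a ^ 'v ^ 'v" where
  "mat_pow A 0 = mat 1"
| "mat_pow A (Suc k) = A ** mat_pow A k"

definition mat_exp :: "complex ^ 'v ^ 'v \<Rightarrow> complex ^ 'v ^ 'v" where
  "mat_exp A = (\<Sum>k. mat_pow A k /\<^sub>R fact k)"

lemma summable_mat_exp:
  fixes A :: "complex ^ 'v ^ 'v"
  shows "summable (\<lambda>k. mat_pow A k /\<^sub>R fact k)"
proof -
  define M where "M = (\<Sum>i\<in>UNIV. \<Sum>j\<in>UNIV. norm (A $ i $ j))"
  have row: "(\<Sum>j\<in>UNIV. norm (A $ i $ j)) \<le> M" for i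
    unfolding M_def by (rule member_le_sum) (auto intro: sum_nonneg)
  have M: "M \<ge> 0"
    unfolding M_def by (intro sum_nonneg) auto
  have entry: "norm (mat_pow A k $ i $ j) \<le> M ^ k" for k i j
  proof (induction k arbitrary: i)
    case 0
    show ?case by (simp add: mat_def)
  next
    case (Suc k)
    have "norm (mat_pow A (Suc k) $ i $ j) \<le> (\<Sum>l\<in>UNIV. norm (A $ i $ l) * M ^ k)"
      unfolding mat_pow.simps matrix_matrix_mult_def
      by (auto simp: norm_mult intro!: sum_norm_le mult_left_mono Suc)
    also have "\<dots> \<le> M ^ Suc k"
      using mult_right_mono[OF row[of i], of "M ^ k"] M by (simp add: sum_distrib_right)
    finally show ?case .
  qed
  have norm_le_sum: "norm x \<le> (\<Sum>i\<in>UNIV. norm (x $ i))" for x :: "'b::real_normed_vector ^ 'v"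
    unfolding norm_vec_def by (rule L2_set_le_sum) simp
  have "norm (mat_pow A k /\<^sub>R fact k) \<le> (real CARD('v))\<^sup>2 * (M ^ k /\<^sub>R fact k)" for k
  proof -
    have "norm (mat_pow A k) \<le> (\<Sum>i\<in>UNIV. \<Sum>j\<in>UNIV. norm (mat_pow A k $ i $ j))"
      by (rule order_trans[OF norm_le_sum sum_mono[OF norm_le_sum]])
    also have "\<dots> \<le> (\<Sum>i\<in>(UNIV::'v set). \<Sum>j\<in>(UNIV::'v set). M ^ k)"
      by (intro sum_mono entry)
    finally show ?thesis
      by (simp add: power2_eq_square field_simps)
  qed
  moreover have sm: "summable (\<lambda>k. (real CARD('v))\<^sup>2 * (M ^ k /\<^sub>R fact k))"
    by (intro summable_mult summable_exp_generic)
  ultimately show ?thesis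
    by (intro summable_comparison_test'[OF sm, of 0])
qed

text \<open>Perfect state transfer from \<open>a\<close> to \<open>b\<close>; \<open>axis a 1\<close> is the standard basis vector at \<open>a\<close>.\<close>

definition PST :: "real ^ 'v ^ 'v \<Rightarrow> 'v \<Rightarrow> 'v \<Rightarrow> bool" where
  "PST K a b \<longleftrightarrow> (\<exists>t>0. \<exists>\<gamma>::complex. cmod \<gamma> = 1 \<and>
     mat_exp (map_matrix (\<lambda>x. - \<i> * complex_of_real t * complex_of_real x) K) *v axis a 1
       = \<gamma> *s axis b 1)"

end

theory Submission
  imports Defs "HOL-Computational_Algebra.Polynomial"
begin

text \<open>Write \<open>M = H\<^sup>2\<close>, whose eigenvalues are nonnegative, so that all powers \<open>M\<^sup>m\<close> with \<open>m > 0\<close>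
  have the eigenspaces of \<open>M\<close>. PST of \<open>M\<^sup>m\<close> from \<open>a\<close> to \<open>b\<close> with phase \<open>\<gamma>\<close> at time \<open>t\<close> means
  \<open>exp (-i t s\<^sup>m) z\<^sub>a = \<gamma> z\<^sub>b\<close> for every real \<open>s\<close>-eigenvector \<open>z\<close>. Taking \<open>s = 0\<close> shows
  that \<open>\<gamma>\<close> is real, hence \<open>t s\<^sup>m = n\<^sub>s \<pi>\<close> with integers \<open>n\<^sub>s\<close> for all \<open>s\<close> in the support.

  The polynomial with simple roots at the support is the minimal polynomial of the rational vector
  \<open>e\<^sub>a\<close>, so it is rational, and so is the product of the \<open>d\<close> nonzero \<open>s\<close>. As the \<open>s\<^sup>m\<close> are
  commensurable, each \<open>s\<^bsup>md\<^esup>\<close> is rational; as \<open>s \<ge> 0\<close>, this forces \<open>s\<close> itself to be rational.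

  Writing \<open>s = g q\<^sub>s\<close> with integers \<open>q\<^sub>s\<close> not all even, the \<open>n\<^sub>s\<close> are proportional to the \<open>q\<^sub>s\<^sup>m\<close> and,
  since \<open>b \<noteq> a\<close>, not all even, so \<open>n\<^sub>s\<close> and \<open>q\<^sub>s\<close> have the same parity. Therefore \<open>M\<^sup>n\<close> has PST
  with the same phase at time \<open>\<pi>/g\<^sup>n\<close>, for every \<open>n > 0\<close>.\<close>

section \<open>Spectral theory of real symmetric matrices\<close>

lemma symmetric_matrix_inner:
  fixes M :: "real ^ 'v ^ 'v"
  assumes "symmetric_matrix M"
  shows "x \<bullet> (M *v y) = (M *v x) \<bullet> y"
  using assms by (metis dot_lmul_matrix symmetric_matrix_def transpose_matrix_vector)

text \<open>A maximiser \<open>v\<close> of the Rayleigh quotient on the unit sphere of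
  \<open>T\<close> is an eigenvector: otherwise moving it along the line of its residual
  \<open>w\<close> would increase the quotient.\<close>

lemma symmetric_eigenvector_in_subspace:
  fixes M :: "real ^ 'v ^ 'v"
  assumes sym: "symmetric_matrix M" and T: "subspace T"
    and inv: "\<And>x. x \<in> T \<Longrightarrow> M *v x \<in> T" and nt: "x0 \<in> T" "x0 \<noteq> 0"
  obtains l z where "z \<in> T" "z \<noteq> 0" "z \<in> eigenspace M l"
proof -
  define C where "C = sphere 0 1 \<inter> T"
  have "compact C"
    unfolding C_def by (intro compact_Int_closed closed_subspace T compact_sphere)
  moreover have "x0 /\<^sub>R norm x0 \<in> C"
    using nt T by (simp add: C_def subspace_scale)
  moreover have "continuous_on C (\<lambda>x. x \<bullet> (M *v x))"
    by (intro continuous_intros matrix_vector_mult_linear_continuous_on)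
  ultimately obtain v where v: "v \<in> C" and max: "\<And>x. x \<in> C \<Longrightarrow> x \<bullet> (M *v x) \<le> v \<bullet> (M *v v)"
    using continuous_attains_sup[of C "\<lambda>x. x \<bullet> (M *v x)"] by blast
  have vT: "v \<in> T" and nv: "v \<bullet> v = 1"
    using v by (auto simp: C_def dot_square_norm)
  define l where "l = v \<bullet> (M *v v)"
  \<comment> \<open>The form of \<open>l\<close> times the identity minus \<open>M\<close>:
    nonnegative on \<open>T\<close> by maximality of \<open>l\<close>, and zero at
    \<open>v\<close>.\<close>
  define g where "g x = l * (x \<bullet> x) - x \<bullet> (M *v x)" for x
  have g_nonneg: "g x \<ge> 0" if "x \<in> T" for x
  proof (cases "x = 0")
    case False
    have "x /\<^sub>R norm x \<in> C"
      using False T that by (simp add: C_def subspace_scale)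
    from max[OF this] have "(x \<bullet> (M *v x)) / (norm x)\<^sup>2 \<le> l"
      by (simp add: l_def matrix_vector_mult_scaleR power2_eq_square divide_inverse mult_ac)
    then show ?thesis
      using False by (simp add: g_def dot_square_norm divide_le_eq)
  qed (simp add: g_def)
  define w where "w = l *\<^sub>R v - M *v v"
  have wT: "w \<in> T"
    unfolding w_def by (intro subspace_diff subspace_scale T vT inv)
  have g_expand: "g (v + t *\<^sub>R w) = 2 * t * (w \<bullet> w) + t\<^sup>2 * g w" for t
  proof -
    have Mvw: "(M *v v) \<bullet> w = l * (v \<bullet> w) - w \<bullet> w"
      using inner_diff_left[of "l *\<^sub>R v" "M *v v" w] by (simp add: w_def)
    have vMw: "v \<bullet> (M *v w) = l * (v \<bullet> w) - w \<bullet> w"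
      by (metis Mvw symmetric_matrix_inner[OF sym])
    have wMv: "w \<bullet> (M *v v) = l * (v \<bullet> w) - w \<bullet> w"
      by (metis Mvw inner_commute)
    have "g (v + t *\<^sub>R w) = l * (v \<bullet> v + t * (v \<bullet> w) + t * (w \<bullet> v) + t\<^sup>2 * (w \<bullet> w))
        - (v \<bullet> (M *v v) + t * (v \<bullet> (M *v w)) + t * (w \<bullet> (M *v v)) + t\<^sup>2 * (w \<bullet> (M *v w)))"
      by (simp add: g_def algebra_simps inner_add_left power2_eq_square)
    also have "\<dots> = 2 * t * (w \<bullet> w) + t\<^sup>2 * g w"
      unfolding vMw wMv nv g_def l_def[symmetric] inner_commute[of w v] by (simp add: algebra_simps)
    finally show ?thesis .
  qed
  have "w = 0"
  proof (rule ccontr)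
    assume "w \<noteq> 0"
    then have B: "w \<bullet> w > 0" by simp
    have G: "g w \<ge> 0" by (rule g_nonneg[OF wT])
    \<comment> \<open>Negative, to make the first-order term of \<open>g_expand\<close> negative,
      and so small that the second-order term cannot compensate.\<close>
    define t where "t = - (w \<bullet> w) / (1 + g w)"
    have t: "t < 0" using B G by (simp add: t_def divide_less_0_iff)
    have "0 \<le> g (v + t *\<^sub>R w)"
      by (intro g_nonneg subspace_add subspace_scale T vT wT)
    then have "0 \<le> t * (2 * (w \<bullet> w) + t * g w)"
      unfolding g_expand by (simp add: algebra_simps power2_eq_square)
    then have "2 * (w \<bullet> w) + t * g w \<le> 0"
      using t by (simp add: zero_le_mult_iff)
    moreover have "t * g w > - (w \<bullet> w) * 1"
      using B G unfolding t_def by (simp add: field_simps)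
    ultimately show False using B by linarith
  qed
  then have "M *v v = l *s v"
    by (simp add: w_def scalar_mult_eq_scaleR)
  then show ?thesis
    using that[of v l] vT nv by (force simp: eigenspace_def)
qed

text \<open>The orthogonal complement of the span is \<open>M\<close>-invariant, so if nonzero it
  contains an eigenvector; this also lies in the span and is orthogonal to itself.\<close>

lemma span_eigenspaces:
  fixes M :: "real ^ 'v ^ 'v"
  assumes sym: "symmetric_matrix M"
  shows "span (\<Union>l. eigenspace M l) = UNIV"
proof (rule ccontr)
  define W where "W = span (\<Union>l. eigenspace M l)"
  assume "span (\<Union>l. eigenspace M l) \<noteq> UNIV"
  then obtain x where "x \<notin> W" unfolding W_def by auto
  obtain y z where yz: "y \<in> W" "\<And>w. w \<in> W \<Longrightarrow> orthogonal z w" "x = y + z"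
    using orthogonal_subspace_decomp_exists[of "\<Union>l. eigenspace M l" x] unfolding W_def by metis
  have "z \<noteq> 0" using yz \<open>x \<notin> W\<close> by auto
  have invW: "M *v w \<in> W" if "w \<in> W" for w
    using that unfolding W_def
  proof (induction rule: span_induct_alt)
    case (step c u w)
    then obtain l where "u \<in> eigenspace M l" by auto
    moreover from this have "M *v u = l *\<^sub>R u"
      by (simp add: eigenspace_def scalar_mult_eq_scaleR)
    ultimately have "M *v u \<in> span (\<Union>l. eigenspace M l)"
      by (metis UN_I UNIV_I span_base span_scale)
    then show ?case
      using step by (simp add: matrix_vector_right_distrib matrix_vector_mult_scaleR span_add span_scale)
  qed (simp add: span_zero)
  define T where "T = {u. \<forall>w\<in>W. orthogonal u w}"
  have "subspace T"
    unfolding T_def subspace_def by (auto simp: orthogonal_def inner_add_left)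
  moreover have "M *v u \<in> T" if "u \<in> T" for u
    using that invW unfolding T_def orthogonal_def
    by (auto simp: symmetric_matrix_inner[OF sym, symmetric])
  moreover have "z \<in> T" using yz by (simp add: T_def)
  ultimately obtain l u where u: "u \<in> T" "u \<noteq> 0" "u \<in> eigenspace M l"
    using symmetric_eigenvector_in_subspace[OF sym _ _ _ \<open>z \<noteq> 0\<close>] by metis
  then have "u \<in> W" unfolding W_def by (auto intro: span_base)
  with u show False by (auto simp: T_def orthogonal_def)
qed

lemma linear_eq_0_on_eigenspaces:
  fixes M :: "real ^ 'v ^ 'v"
  assumes "symmetric_matrix M" "linear f" "\<And>l z. z \<in> eigenspace M l \<Longrightarrow> f z = 0"
  shows "f x = 0"
  using linear_eq_0_on_span[OF assms(2), of "\<Union>l. eigenspace M l" x] assms(3)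
    span_eigenspaces[OF assms(1)] by auto

lemma eigenspaces_orthogonal:
  fixes M :: "real ^ 'v ^ 'v"
  assumes "symmetric_matrix M" "x \<in> eigenspace M l" "y \<in> eigenspace M l'" "l \<noteq> l'"
  shows "x \<bullet> y = 0"
proof -
  have "l * (x \<bullet> y) = l' * (x \<bullet> y)"
    using assms symmetric_matrix_inner[OF assms(1), of x y]
    by (simp add: eigenspace_def scalar_mult_eq_scaleR)
  then show ?thesis using assms(4) by simp
qed

text \<open>One eigenvector per eigenvalue gives orthogonal nonzero vectors, hence an independent
  and so finite set.\<close>

lemma finite_Spec:
  fixes M :: "real ^ 'v ^ 'v"
  assumes "symmetric_matrix M"
  shows "finite (Spec M)"
proof -
  obtain z where z: "\<And>l. l \<in> Spec M \<Longrightarrow> z l \<noteq> 0 \<and> z l \<in> eigenspace M l"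
    using bchoice[of "Spec M" "\<lambda>l z. z \<noteq> 0 \<and> z \<in> eigenspace M l"]
    unfolding Spec_def eigenspace_def by auto
  have orth: "z l \<bullet> z l' = 0" if "l \<in> Spec M" "l' \<in> Spec M" "l \<noteq> l'" for l l'
    using eigenspaces_orthogonal[OF assms] z that by blast
  have "pairwise orthogonal (z ` Spec M)"
    using orth by (auto simp: pairwise_def orthogonal_def)
  moreover have "0 \<notin> z ` Spec M" using z by auto
  ultimately have "finite (z ` Spec M)"
    using pairwise_orthogonal_independent finiteI_independent by blast
  moreover have "inj_on z (Spec M)"
    using orth z by (metis inj_onI inner_eq_zero_iff)
  ultimately show ?thesis by (rule finite_imageD)
qed

text \<open>A vector and its projection have the same inner products with the eigenspace. This
  trades projections for test eigenvectors.\<close>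

lemma eig_supp_iff:
  fixes M :: "real ^ 'v ^ 'v"
  shows "l \<in> eig_supp M x \<longleftrightarrow> (\<exists>z\<in>eigenspace M l. x \<bullet> z \<noteq> 0)"
proof -
  let ?y = "eig_proj M l x"
  have y: "?y \<in> eigenspace M l \<and> (\<forall>z\<in>eigenspace M l. orthogonal (x - ?y) z)"
    unfolding eig_proj_def orth_proj_def
    by (rule theI'[OF orth_proj_ex1[OF subspace_eigenspace]])
  then have eq: "x \<bullet> z = ?y \<bullet> z" if "z \<in> eigenspace M l" for z
    using that by (auto simp: orthogonal_def inner_diff_left)
  show ?thesis
  proof
    assume "l \<in> eig_supp M x"
    then show "\<exists>z\<in>eigenspace M l. x \<bullet> z \<noteq> 0"
      using eq[of ?y] y by (auto simp: eig_supp_def intro!: bexI[of _ ?y])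
  next
    assume "\<exists>z\<in>eigenspace M l. x \<bullet> z \<noteq> 0"
    then have "?y \<noteq> 0"
      using eq by force
    then show "l \<in> eig_supp M x"
      using y by (auto simp: eig_supp_def Spec_def eigenspace_def)
  qed
qed

lemma eig_supp_axis_iff:
  fixes M :: "real ^ 'v ^ 'v"
  shows "l \<in> eig_supp M (axis a 1) \<longleftrightarrow> (\<exists>z\<in>eigenspace M l. z $ a \<noteq> 0)"
  by (simp add: eig_supp_iff inner_axis')

lemma finite_eig_supp:
  fixes M :: "real ^ 'v ^ 'v"
  assumes "symmetric_matrix M"
  shows "finite (eig_supp M x)"
  using finite_Spec[OF assms] by (simp add: eig_supp_def)

section \<open>Matrix powers and the matrix exponential\<close>

lemma eigenspace_mat_pow:
  fixes M :: "real ^ 'v ^ 'v"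
  assumes "z \<in> eigenspace M l"
  shows "mat_pow M k *v z = l ^ k *s z"
proof (induction k)
  case (Suc k)
  have "mat_pow M (Suc k) *v z = M *v (l ^ k *s z)"
    by (simp add: Suc flip: matrix_vector_mul_assoc)
  also have "\<dots> = l ^ k *s (l *s z)"
    using assms by (simp add: eigenspace_def matrix_vector_mult_scaleR scalar_mult_eq_scaleR)
  finally show ?case by (simp add: vector_smult_assoc mult.commute)
qed (simp add: vec_eq_iff)

lemma mat_pow_commute: "mat_pow A k ** A = A ** mat_pow (A :: 'a::semiring_1 ^ 'v ^ 'v) k"
  by (induction k) (simp_all flip: matrix_mul_assoc)

lemma symmetric_mat_pow:
  fixes A :: "'a::comm_semiring_1 ^ 'v ^ 'v"
  assumes "symmetric_matrix A"
  shows "symmetric_matrix (mat_pow A k)"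
  using assms
  by (induction k) (auto simp: symmetric_matrix_def transpose_mat matrix_transpose_mul mat_pow_commute)

lemma mat_pow_mult_2:
  fixes A :: "'a::semiring_1 ^ 'v ^ 'v"
  shows "mat_pow A (2 * k) = mat_pow (A ** A) k"
  by (induction k) (simp_all add: matrix_mul_assoc)

lemma rational_matrix_mult:
  fixes A B :: "real ^ 'v ^ 'v"
  assumes "rational_matrix A" "rational_matrix B"
  shows "rational_matrix (A ** B)"
  using assms unfolding rational_matrix_def matrix_matrix_mult_def by (simp add: Rats_sum)

lemma rational_mat_pow:
  fixes A :: "real ^ 'v ^ 'v"
  assumes "rational_matrix A"
  shows "rational_matrix (mat_pow A k)"
  using assms
  by (induction k) (auto simp: rational_matrix_mult, simp add: rational_matrix_def mat_def)

lemma mat_exp_eigenvector: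
  fixes A :: "complex ^ 'v ^ 'v"
  assumes "A *v x = c *s x"
  shows "mat_exp A *v x = exp c *s x"
proof -
  have p: "mat_pow A k *v x = c ^ k *s x" for k
  proof (induction k)
    case (Suc k)
    have "mat_pow A (Suc k) *v x = A *v (c ^ k *s x)"
      by (simp add: Suc flip: matrix_vector_mul_assoc)
    also have "\<dots> = c ^ k *s (c *s x)"
      using assms by (simp add: vec.scale)
    finally show ?case by (simp add: vector_smult_assoc mult.commute)
  qed (simp add: vec_eq_iff)
  \<comment> \<open>Each coordinate of \<open>B *v x\<close> is bounded linear in \<open>B\<close>,
    so it passes through the series and leaves the scalar exponential series.\<close>
  have "linear (\<lambda>B :: complex ^ 'v ^ 'v. (B *v x) $ i)" for i
    by (rule linearI) (simp_all add: matrix_vector_mult_def sum.distrib algebra_simps scaleR_sum_right)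
  then have bl: "bounded_linear (\<lambda>B :: complex ^ 'v ^ 'v. (B *v x) $ i)" for i
    by (simp add: linear_conv_bounded_linear)
  have "(mat_exp A *v x) $ i = exp c * x $ i" for i
  proof -
    have term_eq: "((mat_pow A k /\<^sub>R fact k) *v x) $ i = (c ^ k /\<^sub>R fact k) * x $ i" for k
    proof -
      have "((mat_pow A k /\<^sub>R fact k) *v x) $ i = (mat_pow A k *v x) $ i /\<^sub>R fact k"
        using bl[THEN bounded_linear.linear, THEN linear_cmul] by blast
      then show ?thesis by (simp add: p)
    qed
    have "(mat_exp A *v x) $ i = (\<Sum>k. ((mat_pow A k /\<^sub>R fact k) *v x) $ i)"
      unfolding mat_exp_def by (rule bounded_linear.suminf[OF bl summable_mat_exp])
    also have "\<dots> = (\<Sum>k. c ^ k /\<^sub>R fact k) * x $ i"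
      unfolding term_eq by (rule suminf_mult2[OF summable_exp_generic, symmetric])
    finally show ?thesis by (simp add: exp_def)
  qed
  then show ?thesis by (simp add: vec_eq_iff)
qed

lemma symmetric_mat_exp:
  fixes A :: "complex ^ 'v ^ 'v"
  assumes "symmetric_matrix A"
  shows "symmetric_matrix (mat_exp A)"
proof -
  have "linear (\<lambda>B :: complex ^ 'v ^ 'v. transpose B)"
    by (rule linearI) (simp_all add: transpose_def vec_eq_iff)
  then have bl: "bounded_linear (\<lambda>B :: complex ^ 'v ^ 'v. transpose B)"
    by (simp add: linear_conv_bounded_linear)
  have tr: "transpose (mat_pow A k /\<^sub>R fact k) = mat_pow A k /\<^sub>R fact k" for k
    using symmetric_mat_pow[OF assms, of k] linear_cmul[OF bounded_linear.linear[OF bl]]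
    by (simp add: symmetric_matrix_def)
  have "transpose (mat_exp A) = (\<Sum>k. transpose (mat_pow A k /\<^sub>R fact k))"
    unfolding mat_exp_def by (rule bounded_linear.suminf[OF bl summable_mat_exp])
  then show ?thesis
    by (simp add: tr symmetric_matrix_def mat_exp_def)
qed

text \<open>Extend 1 to a basis of the reals over the rationals and read off a functional sending 1
  to 1. Its use: a real fixed by \<open>\<phi>\<close> is rational.\<close>

lemma rational_projection_exists:
  obtains \<phi> :: "real \<Rightarrow> real"
  where "\<And>x y. \<phi> (x + y) = \<phi> x + \<phi> y" "\<And>q x. q \<in> \<rat> \<Longrightarrow> \<phi> (q * x) = q * \<phi> x"
    "\<And>q. q \<in> \<rat> \<Longrightarrow> \<phi> q = q" "\<And>x. \<phi> x \<in> \<rat>"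
proof -
  interpret V: vector_space_pair "\<lambda>(q::rat) (x::real). of_rat q * x" "\<lambda>(q::rat) (x::rat). q * x"
    by unfold_locales (simp_all add: algebra_simps of_rat_add of_rat_mult)
  have "V.vs1.independent {1}" by simp
  then obtain g where g: "Vector_Spaces.linear (\<lambda>(q::rat) (x::real). of_rat q * x) (\<lambda>(q::rat) (x::rat). q * x) g"
    and g1: "g 1 = 1"
    using V.linear_independent_extend[of "{1}" "\<lambda>_. 1"] by auto
  interpret g: Vector_Spaces.linear "\<lambda>(q::rat) (x::real). of_rat q * x" "\<lambda>(q::rat) (x::rat). q * x" g
    by (rule g)
  have scale: "of_rat (g (q * x)) = q * (of_rat (g x) :: real)" if "q \<in> \<rat>" for q x
    using that by (auto elim!: Rats_cases simp: g.scale of_rat_mult)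
  show thesis
  proof (rule that[of "\<lambda>x. of_rat (g x)"])
    show "of_rat (g q) = q" if "q \<in> \<rat>" for q
      using scale[OF that, of 1] by (simp add: g1)
  qed (auto simp: g.add of_rat_add scale)
qed

section \<open>Perfect state transfer tested on eigenvectors\<close>

lemma mat_exp_pairing:
  fixes K :: "real ^ 'v ^ 'v"
  assumes sym: "symmetric_matrix K" and z: "K *v z = l *s z"
  shows "(\<Sum>j\<in>UNIV. complex_of_real (z $ j) *
    (mat_exp (map_matrix (\<lambda>x. - \<i> * complex_of_real t * complex_of_real x) K) *v axis a 1) $ j) =
    cis (- (t * l)) * complex_of_real (z $ a)"
proof -
  define A where "A = map_matrix (\<lambda>x. - \<i> * complex_of_real t * complex_of_real x) K"
  define zc :: "complex ^ 'v" where "zc = (\<chi> j. complex_of_real (z $ j))"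
  have "symmetric_matrix A"
    using sym by (simp add: A_def symmetric_matrix_def transpose_def vec_eq_iff)
  then have symE: "mat_exp A $ i $ j = mat_exp A $ j $ i" for i j
    using symmetric_mat_exp[of A] unfolding symmetric_matrix_def transpose_def
    by (metis vec_lambda_beta)
  have "(A *v zc) $ i = - \<i> * t * of_real ((K *v z) $ i)" for i
    unfolding A_def zc_def matrix_vector_mult_def
    by (simp add: sum_distrib_left mult.assoc flip: sum_negf)
  then have "A *v zc = (- \<i> * t * l) *s zc"
    by (simp add: z zc_def vec_eq_iff mult.assoc)
  from mat_exp_eigenvector[OF this]
  have E: "(mat_exp A *v zc) $ a = cis (- (t * l)) * z $ a"
    by (simp add: cis_conv_exp mult.assoc zc_def)
  \<comment> \<open>By symmetry, column \<open>a\<close> of the exponential is its row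
    \<open>a\<close>, so the pairing with \<open>z\<close> is the \<open>a\<close>-entry of the
    exponential applied to \<open>z\<close>.\<close>
  have "(mat_exp A *v axis a 1) $ j = mat_exp A $ a $ j" for j
    using symE[of j a] by (simp add: matrix_vector_mult_def axis_def if_distrib cong: if_cong)
  then have "(\<Sum>j\<in>UNIV. complex_of_real (z $ j) * (mat_exp A *v axis a 1) $ j) = (mat_exp A *v zc) $ a"
    by (simp add: matrix_vector_mult_def zc_def mult.commute)
  then show ?thesis using E by (simp only: A_def)
qed

text \<open>The pairing with \<open>y\<close> is real-linear in \<open>z\<close>, so it vanishes on
  the span of the real eigenvectors, in particular on the standard basis.\<close>

lemma annihilator_eigenspaces_trivial:
  fixes M :: "real ^ 'v ^ 'v" and y :: "complex ^ 'v"
  assumes sym: "symmetric_matrix M"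
    and ann: "\<And>l z. z \<in> eigenspace M l \<Longrightarrow> (\<Sum>j\<in>UNIV. complex_of_real (z $ j) * y $ j) = 0"
  shows "y = 0"
proof -
  have "linear (\<lambda>z :: real ^ 'v. \<Sum>j\<in>UNIV. complex_of_real (z $ j) * y $ j)"
    by (rule linearI) (simp_all add: sum.distrib distrib_right scaleR_conv_of_real[where 'a = complex] sum_distrib_left mult.assoc)
  from linear_eq_0_on_eigenspaces[OF sym this] ann
  have *: "(\<Sum>j\<in>UNIV. complex_of_real (z $ j) * y $ j) = 0" for z by blast
  have "y $ i = 0" for i
  proof -
    have "(\<Sum>j\<in>UNIV. complex_of_real (axis i (1::real) $ j) * y $ j) = (\<Sum>j\<in>UNIV. if j = i then y $ j else 0)"
      by (intro sum.cong refl) (simp add: axis_def)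
    then show ?thesis using *[of "axis i 1"] by simp
  qed
  then show ?thesis by (simp add: vec_eq_iff)
qed

text \<open>Pair both sides of the transfer equation with the eigenvectors of \<open>M\<close>,
  which span. Testing on \<open>M\<close> itself gives one family of vectors for all exponents
  \<open>m\<close>.\<close>

lemma PST_mat_pow_iff:
  fixes M :: "real ^ 'v ^ 'v"
  assumes sym: "symmetric_matrix M"
  shows "PST (mat_pow M m) a b \<longleftrightarrow> (\<exists>t>0. \<exists>\<gamma>::complex. cmod \<gamma> = 1 \<and>
    (\<forall>l. \<forall>z\<in>eigenspace M l. cis (- (t * l ^ m)) * z $ a = \<gamma> * z $ b))"
proof -
  have "mat_exp (map_matrix (\<lambda>x. - \<i> * complex_of_real t * complex_of_real x) (mat_pow M m)) *v axis a 1
       = \<gamma> *s axis b 1 \<longleftrightarrow>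
    (\<forall>l. \<forall>z\<in>eigenspace M l. cis (- (t * l ^ m)) * z $ a = \<gamma> * z $ b)" for t and \<gamma> :: complex
  proof -
    define u where "u = mat_exp (map_matrix (\<lambda>x. - \<i> * complex_of_real t * complex_of_real x) (mat_pow M m)) *v axis a 1"
    have 1: "(\<Sum>j\<in>UNIV. complex_of_real (z $ j) * u $ j) = cis (- (t * l ^ m)) * z $ a"
      if "z \<in> eigenspace M l" for z l
      unfolding u_def by (rule mat_exp_pairing[OF symmetric_mat_pow[OF sym] eigenspace_mat_pow[OF that]])
    have 2: "(\<Sum>j\<in>UNIV. complex_of_real (z $ j) * (\<gamma> *s axis b 1) $ j) = \<gamma> * z $ b" for z :: "real ^ 'v"
    proof -
      have "(\<Sum>j\<in>UNIV. complex_of_real (z $ j) * (\<gamma> *s axis b 1) $ j) =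
          (\<Sum>j\<in>UNIV. if j = b then \<gamma> * complex_of_real (z $ j) else 0)"
        by (intro sum.cong refl) (simp add: axis_def)
      then show ?thesis by simp
    qed
    have "u = \<gamma> *s axis b 1 \<longleftrightarrow> (\<forall>l. \<forall>z\<in>eigenspace M l. cis (- (t * l ^ m)) * z $ a = \<gamma> * z $ b)"
    proof
      assume "u = \<gamma> *s axis b 1"
      then show "\<forall>l. \<forall>z\<in>eigenspace M l. cis (- (t * l ^ m)) * z $ a = \<gamma> * z $ b"
        using 1 2 by metis
    next
      assume *: "\<forall>l. \<forall>z\<in>eigenspace M l. cis (- (t * l ^ m)) * z $ a = \<gamma> * z $ b"
      have "u - \<gamma> *s axis b 1 = 0"
      proof (rule annihilator_eigenspaces_trivial[OF sym])
        fix l z assume z: "z \<in> eigenspace M l"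
        show "(\<Sum>j\<in>UNIV. complex_of_real (z $ j) * (u - \<gamma> *s axis b 1) $ j) = 0"
          using 1[OF z] 2[of z] * z
          by (simp add: right_diff_distrib sum_subtractf)
      qed
      then show "u = \<gamma> *s axis b 1" by simp
    qed
    then show ?thesis by (simp add: u_def)
  qed
  then show ?thesis unfolding PST_def by simp
qed

section \<open>Rationality of the eigenvalue support\<close>

lemma krylov_relation_iff:
  fixes M :: "real ^ 'v ^ 'v"
  assumes sym: "symmetric_matrix M"
  shows "(\<Sum>j\<le>n. c j *\<^sub>R (mat_pow M j *v axis a 1)) = 0 \<longleftrightarrow>
    (\<forall>s\<in>eig_supp M (axis a 1). (\<Sum>j\<le>n. c j * s ^ j) = 0)" (is "?y = 0 \<longleftrightarrow> _")
proof -
  \<comment> \<open>\<open>?y\<close> is a polynomial in \<open>M\<close> applied to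
    \<open>axis a 1\<close>; moving the powers of \<open>M\<close> onto \<open>z\<close> evaluates
    the polynomial at \<open>s\<close>.\<close>
  have inner_y: "?y \<bullet> z = (\<Sum>j\<le>n. c j * s ^ j) * z $ a" if z: "z \<in> eigenspace M s" for z s
  proof -
    have "(mat_pow M j *v axis a 1) \<bullet> z = s ^ j * z $ a" for j
      using symmetric_matrix_inner[OF symmetric_mat_pow[OF sym, of j], of "axis a 1" z]
      by (simp add: eigenspace_mat_pow[OF z] inner_axis')
    then show ?thesis
      by (simp add: inner_sum_left sum_distrib_right mult.assoc)
  qed
  show ?thesis
  proof
    assume "?y = 0"
    then show "\<forall>s\<in>eig_supp M (axis a 1). (\<Sum>j\<le>n. c j * s ^ j) = 0"
      using inner_y by (fastforce simp: eig_supp_axis_iff)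
  next
    assume *: "\<forall>s\<in>eig_supp M (axis a 1). (\<Sum>j\<le>n. c j * s ^ j) = 0"
    have "linear (\<lambda>z. ?y \<bullet> z)"
      by (rule linearI) (simp_all add: inner_add_right)
    moreover have "?y \<bullet> z = 0" if "z \<in> eigenspace M s" for z s
      using * that inner_y[OF that] by (cases "z $ a = 0") (auto simp: eig_supp_axis_iff)
    ultimately have "?y \<bullet> ?y = 0"
      using linear_eq_0_on_eigenspaces[OF sym] by blast
    then show "?y = 0" by simp
  qed
qed

text \<open>The sum runs to the degree of \<open>p\<close> because \<open>f\<close> may kill leading
  coefficients.\<close>

lemma poly_map_poly_altdef:
  fixes f :: "'a::zero \<Rightarrow> 'b::comm_semiring_1"
  assumes "f 0 = 0"
  shows "poly (map_poly f p) x = (\<Sum>j\<le>degree p. f (coeff p j) * x ^ j)"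
proof -
  have "poly (map_poly f p) x = (\<Sum>j\<le>degree (map_poly f p). f (coeff p j) * x ^ j)"
    by (simp add: poly_altdef coeff_map_poly assms)
  also have "\<dots> = (\<Sum>j\<le>degree p. f (coeff p j) * x ^ j)"
  proof (rule sum.mono_neutral_left)
    show "\<forall>j\<in>{..degree p} - {..degree (map_poly f p)}. f (coeff p j) * x ^ j = 0"
      by (metis Diff_iff assms atMost_iff coeff_eq_0 coeff_map_poly mult_zero_left not_le)
  qed (auto simp: map_poly_degree_leq assms)
  finally show ?thesis .
qed

text \<open>Plays the role of Galois conjugation: \<open>M\<close> and \<open>axis a 1\<close> are rational, so a \<open>\<rat>\<close>-linear map
  applied to the coefficients of an annihilating polynomial yields an annihilating polynomial.\<close>

lemma map_poly_vanishes_on_eig_supp: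
  fixes M :: "real ^ 'v ^ 'v" and \<phi> :: "real \<Rightarrow> real"
  assumes sym: "symmetric_matrix M" and rat: "rational_matrix M"
    and add: "\<And>x y. \<phi> (x + y) = \<phi> x + \<phi> y" and scale: "\<And>q x. q \<in> \<rat> \<Longrightarrow> \<phi> (q * x) = q * \<phi> x"
    and van: "\<And>s. s \<in> eig_supp M (axis a 1) \<Longrightarrow> poly p s = 0"
    and s: "s \<in> eig_supp M (axis a 1)"
  shows "poly (map_poly \<phi> p) s = 0"
proof -
  let ?v = "\<lambda>j. mat_pow M j *v axis a 1"
  have phi0: "\<phi> 0 = 0" using add[of 0 0] by simp
  have phi_sum: "\<phi> (sum f A) = (\<Sum>x\<in>A. \<phi> (f x))" for f and A :: "nat set"
    by (induction A rule: infinite_finite_induct) (simp_all add: phi0 add)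
  have entry: "?v j $ i \<in> \<rat>" for i j
    using rational_mat_pow[OF rat, of j]
    by (simp add: matrix_vector_mult_basis column_def rational_matrix_def)
  have "(\<Sum>j\<le>degree p. coeff p j *\<^sub>R ?v j) = 0"
    using van by (simp add: krylov_relation_iff[OF sym] poly_altdef)
  then have "(\<Sum>j\<le>degree p. coeff p j * ?v j $ i) = 0" for i
    by (simp add: vec_eq_iff)
  then have "(\<Sum>j\<le>degree p. \<phi> (coeff p j * ?v j $ i)) = 0" for i
    by (metis phi0 phi_sum)
  moreover have "\<phi> (coeff p j * ?v j $ i) = \<phi> (coeff p j) * ?v j $ i" for i j
    by (metis entry scale mult.commute)
  ultimately have "(\<Sum>j\<le>degree p. \<phi> (coeff p j) * ?v j $ i) = 0" for i
    by simp
  then have "(\<Sum>j\<le>degree p. \<phi> (coeff p j) *\<^sub>R ?v j) = 0"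
    by (simp add: vec_eq_iff)
  then show ?thesis
    using s by (simp add: krylov_relation_iff[OF sym] poly_map_poly_altdef[of \<phi>, OF phi0])
qed

lemma coeff_prod_Rats:
  assumes "\<And>x j. x \<in> A \<Longrightarrow> coeff (f x) j \<in> \<rat>"
  shows "coeff (prod f A) j \<in> (\<rat> :: 'a::field_char_0 set)"
  using assms
proof (induction A arbitrary: j rule: infinite_finite_induct)
  case (insert x F)
  then show ?case by (auto simp: coeff_mult)
qed (auto simp: coeff_1)

text \<open>Applying \<open>\<phi>\<close> to the monic polynomial \<open>p\<close> with simple
  roots at the support gives another polynomial vanishing there. The leading terms cancel in the
  difference \<open>r\<close>, which then has too many roots for its degree; so
  \<open>\<phi>\<close> fixes all coefficients.\<close>

lemma coeff_prod_eig_supp_Rats: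
  fixes M :: "real ^ 'v ^ 'v"
  assumes sym: "symmetric_matrix M" and rat: "rational_matrix M"
  shows "coeff (\<Prod>s\<in>eig_supp M (axis a 1). [:- s, 1:]) j \<in> \<rat>"
proof -
  define S where "S = eig_supp M (axis a 1)"
  define p where "p = (\<Prod>s\<in>S. [:- s, 1:])"
  have fin: "finite S" unfolding S_def by (rule finite_eig_supp[OF sym])
  obtain \<phi> :: "real \<Rightarrow> real" where
    phi: "\<And>x y. \<phi> (x + y) = \<phi> x + \<phi> y" "\<And>q x. q \<in> \<rat> \<Longrightarrow> \<phi> (q * x) = q * \<phi> x"
      "\<And>q. q \<in> \<rat> \<Longrightarrow> \<phi> q = q" "\<And>x. \<phi> x \<in> \<rat>"
    by (rule rational_projection_exists, rule that)
  have phi0: "\<phi> 0 = 0" by (simp add: phi(3))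
  have deg: "degree p = card S"
    unfolding p_def by (subst degree_prod_sum_eq) auto
  have lead: "coeff p (card S) = 1"
    using lead_coeff_prod[of "\<lambda>s. [:- s, 1:]" S] by (simp add: p_def[symmetric] deg)
  define r where "r = map_poly \<phi> p - p"
  have r_roots: "S \<subseteq> {x. poly r x = 0}"
  proof
    fix s assume s: "s \<in> S"
    have van: "poly p s = 0" if "s \<in> S" for s
      using that fin by (auto simp: p_def poly_prod)
    then show "s \<in> {x. poly r x = 0}"
      using map_poly_vanishes_on_eig_supp[OF sym rat phi(1,2), of a p s] s by (simp add: S_def r_def)
  qed
  have r_deg: "degree r < card S" if "r \<noteq> 0"
  proof -
    have "degree r \<le> card S"
      unfolding r_def using map_poly_degree_leq[of \<phi> p] phi0 deg by (intro degree_diff_le) auto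
    moreover have "coeff r (card S) = 0"
      by (simp add: r_def coeff_map_poly phi0 lead phi(3))
    ultimately show ?thesis
      using that by (metis le_neq_implies_less leading_coeff_0_iff)
  qed
  have "r = 0"
  proof (rule ccontr)
    assume "r \<noteq> 0"
    then have "card S \<le> degree r"
      using card_mono[OF poly_roots_finite r_roots] card_poly_roots_bound[of r] by linarith
    with r_deg \<open>r \<noteq> 0\<close> show False by simp
  qed
  then have "\<phi> (coeff p j) = coeff p j"
    by (metis coeff_map_poly eq_iff_diff_eq_0 phi0 r_def)
  then show ?thesis
    using phi(4) by (metis S_def p_def)
qed

lemma eig_supp_root_rational:
  fixes M :: "real ^ 'v ^ 'v"
  assumes sym: "symmetric_matrix M" and rat: "rational_matrix M"
    and nonneg: "\<And>s. s \<in> eig_supp M (axis a 1) \<Longrightarrow> s \<ge> 0"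
    and pow: "\<And>s. s \<in> eig_supp M (axis a 1) \<Longrightarrow> s ^ N \<in> \<rat>" and N: "N > 0"
    and s0: "s0 \<in> eig_supp M (axis a 1)"
  shows "s0 \<in> \<rat>"
proof -
  define S where "S = eig_supp M (axis a 1)"
  have fin: "finite S" unfolding S_def by (rule finite_eig_supp[OF sym])
  obtain \<phi> :: "real \<Rightarrow> real" where
    phi: "\<And>x y. \<phi> (x + y) = \<phi> x + \<phi> y" "\<And>q x. q \<in> \<rat> \<Longrightarrow> \<phi> (q * x) = q * \<phi> x"
      "\<And>q. q \<in> \<rat> \<Longrightarrow> \<phi> q = q" "\<And>x. \<phi> x \<in> \<rat>"
    by (rule rational_projection_exists, rule that)
  have phi0: "\<phi> 0 = 0" by (simp add: phi(3))
  \<comment> \<open>A rational polynomial vanishing on the rest of the support. It is nonzero at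
    \<open>s0\<close>, since taking \<open>N\<close>-th powers is injective on nonnegative
    reals.\<close>
  define h where "h = (\<Prod>s\<in>S - {s0}. monom 1 N - [:s ^ N:])"
  have h_rat: "coeff h j \<in> \<rat>" for j
    unfolding h_def
    by (rule coeff_prod_Rats) (use pow in \<open>auto simp: S_def coeff_pCons split: nat.splits\<close>)
  have h_poly: "poly h x = (\<Prod>s\<in>S - {s0}. x ^ N - s ^ N)" for x
    by (simp add: h_def poly_prod poly_monom)
  have h_s0: "poly h s0 \<noteq> 0"
    using fin nonneg s0 N by (auto simp: h_poly S_def power_eq_iff_eq_base)
  have "poly ([:- s0, 1:] * h) s = 0" if "s \<in> eig_supp M (axis a 1)" for s
    using that fin by (auto simp: h_poly S_def)
  from map_poly_vanishes_on_eig_supp[OF sym rat phi(1,2) this s0]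
  have "poly (map_poly \<phi> ([:- s0, 1:] * h)) s0 = 0" .
  \<comment> \<open>Rational coefficients of \<open>h\<close> pass through \<open>\<phi>\<close>, so
    only the root \<open>s0\<close> is altered. As \<open>h\<close> does not vanish at
    \<open>s0\<close>, the linear factor must.\<close>
  also have "map_poly \<phi> ([:- s0, 1:] * h) = [:- \<phi> s0, 1:] * h"
  proof (rule poly_eqI)
    fix j
    have "\<phi> (coeff h i - s0 * coeff h j) = coeff h i - \<phi> s0 * coeff h j" for i
      using phi(1)[of "coeff h i" "(- coeff h j) * s0"] phi(2)[of "- coeff h j" s0] phi(3)[OF h_rat]
        h_rat by (simp add: mult.commute)
    moreover have "\<phi> (- s0 * coeff h j) = - \<phi> s0 * coeff h j"
      using phi(2)[of "- coeff h j" s0] h_rat by (simp add: mult.commute)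
    ultimately show "coeff (map_poly \<phi> ([:- s0, 1:] * h)) j = coeff ([:- \<phi> s0, 1:] * h) j"
      by (auto simp: coeff_map_poly phi0 coeff_pCons split: nat.splits)
  qed
  finally have "s0 = \<phi> s0"
    using h_s0 by simp
  then show ?thesis using phi(4) by metis
qed

lemma commensurable_eig_supp_rational:
  fixes M :: "real ^ 'v ^ 'v"
  assumes sym: "symmetric_matrix M" and rat: "rational_matrix M"
    and nonneg: "\<And>s. s \<in> eig_supp M (axis a 1) \<Longrightarrow> s \<ge> 0"
    and zero: "0 \<in> eig_supp M (axis a 1)"
    and pow: "\<And>s. s \<in> eig_supp M (axis a 1) \<Longrightarrow> s ^ m = c * of_int (n s)" and m: "m > 0"
    and s0: "s0 \<in> eig_supp M (axis a 1)"
  shows "s0 \<in> \<rat>"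
proof (cases "s0 = 0")
  case False
  define S where "S = eig_supp M (axis a 1)"
  define T where "T = S - {0}"
  have fin: "finite S" unfolding S_def by (rule finite_eig_supp[OF sym])
  have T: "finite T" "S = insert 0 T" "0 \<notin> T" "s0 \<in> T"
    using fin zero s0 False by (auto simp: T_def S_def)
  define d where "d = card T"
  have d: "d > 0" using T by (auto simp: d_def card_gt_0_iff)
  \<comment> \<open>As 0 is a simple root, the coefficient of the linear term is, up to sign, the
    product of the nonzero support elements.\<close>
  have "(\<Prod>s\<in>S. [:- s, 1:]) = [:0, 1:] * (\<Prod>s\<in>T. [:- s, 1:])"
    using T by simp
  then have "coeff (\<Prod>s\<in>S. [:- s, 1:]) 1 = poly (\<Prod>s\<in>T. [:- s, 1:]) 0"
    by (simp add: poly_0_coeff_0)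
  also have "\<dots> = (\<Prod>s\<in>T. - s)" by (simp add: poly_prod)
  finally have "(\<Prod>s\<in>T. - s) \<in> \<rat>"
    using coeff_prod_eig_supp_Rats[OF sym rat, of a 1] by (simp add: S_def)
  then have "(\<Prod>s\<in>T. - s) * (- 1) ^ card T \<in> \<rat>"
    by (intro Rats_mult Rats_power) auto
  also have "(\<Prod>s\<in>T. - s) * (- 1) ^ card T = \<Prod>T"
    by (simp add: prod_uminus)
  finally have "\<Prod>T ^ m \<in> \<rat>" by simp
  also have "\<Prod>T ^ m = (\<Prod>s\<in>T. c * of_int (n s))"
    unfolding prod_power_distrib using pow by (intro prod.cong) (auto simp: T_def S_def)
  also have "\<dots> = c ^ d * (\<Prod>s\<in>T. of_int (n s))"
    by (simp add: prod.distrib d_def)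
  finally have *: "c ^ d * (\<Prod>s\<in>T. of_int (n s)) \<in> \<rat>" .
  have nz: "(\<Prod>s\<in>T. real_of_int (n s)) \<noteq> 0"
    using pow T(1,3) by (auto simp: T_def S_def) (metis mult_zero_right of_int_0 power_eq_0_iff)
  have "(\<Prod>s\<in>T. real_of_int (n s)) \<in> \<rat>" by auto
  with * have "c ^ d * (\<Prod>s\<in>T. of_int (n s)) / (\<Prod>s\<in>T. of_int (n s)) \<in> \<rat>"
    by (rule Rats_divide)
  then have cd: "c ^ d \<in> \<rat>" using nz by simp
  \<comment> \<open>\<open>c\<close> itself may be irrational; the extra exponent \<open>d\<close>
    turns it into the rational \<open>c ^ d\<close>.\<close>
  have "s ^ (m * d) \<in> \<rat>" if "s \<in> eig_supp M (axis a 1)" for s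
    using cd pow[OF that] by (simp add: power_mult power_mult_distrib)
  from eig_supp_root_rational[OF sym rat nonneg this _ s0] show ?thesis
    using m d by simp
qed simp

section \<open>Parity and transfer between powers\<close>

lemma common_scale_with_odd:
  fixes S :: "real set"
  assumes fin: "finite S" and S: "\<And>s. s \<in> S \<Longrightarrow> s \<in> \<rat> \<and> s \<ge> 0" and pos: "s1 \<in> S" "s1 > 0"
  obtains g q s0 where "g > 0" "\<And>s. s \<in> S \<Longrightarrow> s = g * real (q s)" "s0 \<in> S" "odd (q s0)"
proof -
  \<comment> \<open>Clear denominators with \<open>D\<close>, then divide by the gcd
    \<open>d\<close>; the scale will be \<open>d / D\<close>.\<close>
  have "\<exists>D>0::nat. \<forall>s\<in>S. real D * s \<in> \<nat>"
    using fin S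
  proof (induction S rule: finite_induct)
    case (insert x F)
    then obtain D where D: "D > 0" "\<forall>s\<in>F. real D * s \<in> \<nat>" by auto
    obtain u v :: nat where uv: "v \<noteq> 0" "x = real u / real v"
      using Rats_abs_nat_div_natE[of x] insert.prems[of x] by (metis abs_of_nonneg insertI1)
    have "real (D * v) * s \<in> \<nat>" if "s \<in> insert x F" for s
    proof (cases "s = x")
      case True
      then have "real (D * v) * s = real (D * u)" using uv by simp
      then show ?thesis by (metis of_nat_in_Nats)
    next
      case False
      then have "real D * s \<in> \<nat>" using D that by simp
      then have "real v * (real D * s) \<in> \<nat>" by (rule Nats_mult[OF of_nat_in_Nats])
      then show ?thesis by (simp add: mult_ac)
    qed
    then show ?case
      using D uv by (intro exI[of _ "D * v"]) auto
  qed auto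
  then obtain D :: nat where D: "D > 0" "\<forall>s\<in>S. real D * s \<in> \<nat>" by blast
  then have "\<forall>s\<in>S. \<exists>k. real D * s = real k" by (auto elim!: Nats_cases)
  then obtain p where p: "\<And>s. s \<in> S \<Longrightarrow> real D * s = real (p s)" by metis
  define d where "d = Gcd (p ` S)"
  have dvd: "d dvd p s" if "s \<in> S" for s
    using that by (auto simp: d_def)
  \<comment> \<open>A positive element keeps the gcd from being 0.\<close>
  have "real (p s1) > 0"
    unfolding p[OF pos(1), symmetric] using pos D by simp
  then have "p s1 \<noteq> 0" by simp
  then have d: "d > 0" using dvd[OF pos(1)] by (auto intro: gr0I)
  define q where "q s = p s div d" for s
  have pq: "p s = d * q s" if "s \<in> S" for s
    using dvd[OF that] by (simp add: q_def)
  have "\<exists>s0\<in>S. odd (q s0)"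
  proof (rule ccontr)
    assume "\<not> ?thesis"
    \<comment> \<open>If all quotients were even, twice the gcd would be a common divisor.\<close>
    then have "d * 2 dvd p s" if "s \<in> S" for s
      using that pq by (auto intro: mult_dvd_mono)
    then have "d * 2 dvd d" unfolding d_def by (intro Gcd_greatest) auto
    then show False using d by (auto dest: dvd_imp_le)
  qed
  then obtain s0 where "s0 \<in> S" "odd (q s0)" by blast
  moreover have "s = (d / D) * real (q s)" if "s \<in> S" for s
    using p[OF that] pq[OF that] D by (simp add: field_simps)
  ultimately show thesis
    using that[of "d / D" q s0] d D by simp
qed

lemma cis_minus_int_pi: "cis (- (of_int k * pi)) = (if even k then 1 else - 1)"
  using cos_npi_int[of k] sin_npi_int[of k] by (auto simp: complex_eq_iff mult.commute)

lemma PST_mat_pow_transfer: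
  fixes M :: "real ^ 'v ^ 'v"
  assumes sym: "symmetric_matrix M" and rat: "rational_matrix M"
    and nonneg: "\<And>s. s \<in> eig_supp M (axis a 1) \<Longrightarrow> s \<ge> 0"
    and zero: "0 \<in> eig_supp M (axis a 1)" and ab: "b \<noteq> a"
    and m: "m > 0" and pst: "PST (mat_pow M m) a b"
  shows "eig_supp M (axis a 1) \<subseteq> \<rat>" and "n > 0 \<Longrightarrow> PST (mat_pow M n) a b"
proof -
  define S where "S = eig_supp M (axis a 1)"
  obtain t \<gamma> where t: "t > 0" and g1: "cmod \<gamma> = 1"
    and tr: "\<And>l z. z \<in> eigenspace M l \<Longrightarrow> cis (- (t * l ^ m)) * z $ a = \<gamma> * z $ b"
    using pst unfolding PST_mat_pow_iff[OF sym] by blast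
  \<comment> \<open>Off the support \<open>z $ a\<close> vanishes, and then so does
    \<open>z $ b\<close> since \<open>\<gamma>\<close> is nonzero: the transfer equation is trivial
    there at every time.\<close>
  have outside: "z $ a = 0 \<and> z $ b = 0" if "z \<in> eigenspace M l" "l \<notin> S" for z l
    using tr[OF that(1)] that g1 by (auto simp: S_def eig_supp_axis_iff)
  obtain z0 where z0: "z0 \<in> eigenspace M 0" "z0 $ a \<noteq> 0"
    using zero by (auto simp: eig_supp_axis_iff)
  have "complex_of_real (z0 $ a) = \<gamma> * z0 $ b"
    using tr[OF z0(1)] m by (simp add: power_0_left)
  then have "Im (\<gamma> * z0 $ b) = 0" "z0 $ b \<noteq> 0"
    using z0(2) by (metis Im_complex_of_real, auto)
  then have "Im \<gamma> = 0" by simp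
  have "\<exists>k::int. t * s ^ m = of_int k * pi" if s: "s \<in> S" for s
  proof -
    obtain z where z: "z \<in> eigenspace M s" "z $ a \<noteq> 0"
      using s by (auto simp: S_def eig_supp_axis_iff)
    have "Im (cis (- (t * s ^ m)) * z $ a) = 0"
      unfolding tr[OF z(1)] using \<open>Im \<gamma> = 0\<close> by simp
    then show ?thesis using z(2) by (simp add: sin_zero_iff_int2)
  qed
  then obtain N :: "real \<Rightarrow> int" where N: "\<And>s. s \<in> S \<Longrightarrow> t * s ^ m = of_int (N s) * pi" by metis
  then have "s ^ m = pi / t * of_int (N s)" if "s \<in> S" for s
    using that t by (simp add: field_simps)
  then have S_rat: "s \<in> \<rat>" if "s \<in> S" for s
    using commensurable_eig_supp_rational[OF sym rat nonneg zero _ m] that unfolding S_def by blast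
  then show "eig_supp M (axis a 1) \<subseteq> \<rat>" by (auto simp: S_def)
  \<comment> \<open>If all \<open>N s\<close> were even, every phase would be 1, so
    \<open>z $ a = \<gamma> * z $ b\<close> on eigenvectors and by linearity everywhere;
    \<open>axis a 1\<close> contradicts this.\<close>
  have "\<exists>s\<in>S. odd (N s)"
  proof (rule ccontr)
    assume ev: "\<not> ?thesis"
    have "linear (\<lambda>z :: real ^ 'v. complex_of_real (z $ a) - \<gamma> * z $ b)"
      by (rule linearI) (simp_all add: algebra_simps scaleR_conv_of_real[where 'a = complex])
    moreover have "complex_of_real (z $ a) - \<gamma> * z $ b = 0" if z: "z \<in> eigenspace M l" for z l
    proof (cases "l \<in> S")
      case True
      then show ?thesis
        using tr[OF z] ev by (simp add: N cis_minus_int_pi)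
    qed (simp add: outside[OF z])
    ultimately have "complex_of_real (axis a (1::real) $ a) - \<gamma> * (axis a (1::real) $ b) = 0"
      using linear_eq_0_on_eigenspaces[OF sym] by blast
    then show False using ab by (simp add: axis_def)
  qed
  then obtain s1 where s1: "s1 \<in> S" "odd (N s1)" by blast
  have "s1 \<noteq> 0" using N[OF s1(1)] s1(2) m by (auto simp: power_0_left)
  then have s1_pos: "s1 > 0" using nonneg s1 by (force simp: S_def)
  have "\<And>s. s \<in> S \<Longrightarrow> s \<in> \<rat> \<and> s \<ge> 0" using S_rat nonneg by (auto simp: S_def)
  then obtain g q s0 where g: "g > 0" and q: "\<And>s. s \<in> S \<Longrightarrow> s = g * real (q s)"
    and s0: "s0 \<in> S" "odd (q s0)"
    using common_scale_with_odd[OF finite_eig_supp[OF sym, of "axis a 1", folded S_def] _ s1(1) s1_pos]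
    by metis
  \<comment> \<open>Eliminate \<open>t\<close> and \<open>g\<close> between two support elements;
    only an integer identity remains, which can be read modulo 2.\<close>
  have cross: "N s * int (q s0) ^ m = N s0 * int (q s) ^ m" if s: "s \<in> S" for s
  proof -
    have e: "of_int (N s) * pi = t * g ^ m * real (q s) ^ m" if "s \<in> S" for s
      using N[OF that] q[OF that] by (metis mult.assoc power_mult_distrib)
    have "of_int (N s) * pi * real (q s0) ^ m = of_int (N s0) * pi * real (q s) ^ m"
      unfolding e[OF s] e[OF s0(1)] by simp
    then have "real_of_int (N s * int (q s0) ^ m) = real_of_int (N s0 * int (q s) ^ m)"
      by simp
    then show ?thesis by (simp only: of_int_eq_iff)
  qed
  \<comment> \<open>For \<open>s1\<close> the left side of \<open>cross\<close> is odd, hence so is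
    the factor \<open>N s0\<close>. With \<open>N s0\<close> and \<open>q s0\<close> odd,
    \<open>cross\<close> then compares the parities of \<open>N s\<close> and
    \<open>q s\<close>.\<close>
  have "odd (N s0)"
    using cross[OF s1(1)] s1(2) s0(2) by (metis even_mult_iff even_power even_of_nat)
  then have parity: "even (N s) \<longleftrightarrow> even (q s)" if "s \<in> S" for s
    using cross[OF that] s0(2) m by (metis even_mult_iff even_power even_of_nat)
  show "PST (mat_pow M n) a b" if n: "n > 0"
    unfolding PST_mat_pow_iff[OF sym]
  proof (intro exI[of _ "pi / g ^ n"] exI[of _ \<gamma>] conjI allI ballI)
    fix l z assume z: "z \<in> eigenspace M l"
    show "cis (- (pi / g ^ n * l ^ n)) * z $ a = \<gamma> * z $ b"
    proof (cases "l \<in> S")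
      case True
      \<comment> \<open>At this time the angle is \<open>q l ^ n\<close> half turns; since
        \<open>n > 0\<close> its parity is that of \<open>q l\<close>, hence of \<open>N l\<close>,
        and the original phase recurs.\<close>
      have "pi / g ^ n * l ^ n = of_int (int (q l) ^ n) * pi"
        using g by (subst q[OF True]) (simp add: power_mult_distrib)
      then have "cis (- (pi / g ^ n * l ^ n)) = cis (- (t * l ^ m))"
        unfolding N[OF True] by (simp only: cis_minus_int_pi) (simp add: parity[OF True] n)
      then show ?thesis using tr[OF z] by simp
    qed (simp add: outside[OF z])
  qed (use g g1 in auto)
qed

section \<open>Even powers of \<open>H\<close> as powers of its square\<close>

theorem theorem1p5:
  fixes H :: "real ^ 'v ^ 'v" and a b :: 'v
  assumes "symmetric_matrix H" and "rational_matrix H"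
    and "0 \<in> eig_supp H (axis a 1)"
    and "b \<noteq> a"
  shows "((\<forall>k>0. even k \<longrightarrow> \<not> PST (mat_pow H k) a b) \<or>
          (\<forall>k>0. even k \<longrightarrow> PST (mat_pow H k) a b)) \<and>
         ((\<exists>k>0. even k \<and> PST (mat_pow H k) a b) \<longrightarrow>
          (\<forall>l\<in>eig_supp H (axis a 1). l\<^sup>2 \<in> \<rat>))"
proof -
  define M where "M = H ** H"
  have sym: "symmetric_matrix M"
    using assms(1) by (simp add: M_def symmetric_matrix_def matrix_transpose_mul)
  have rat: "rational_matrix M"
    unfolding M_def by (rule rational_matrix_mult[OF assms(2,2)])
  have nonneg: "s \<ge> 0" if supp: "s \<in> eig_supp M (axis a 1)" for s
  proof -
    obtain z where z: "z \<in> eigenspace M s" "z \<noteq> 0"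
      using supp by (force simp: eig_supp_axis_iff)
    \<comment> \<open>An eigenvalue of the square, times the squared norm of \<open>z\<close>, is
      the squared norm of \<open>H *v z\<close>.\<close>
    have "s * (z \<bullet> z) = (H *v z) \<bullet> (H *v z)"
      using z symmetric_matrix_inner[OF assms(1), of z "H *v z"]
      by (simp add: M_def eigenspace_def scalar_mult_eq_scaleR flip: matrix_vector_mul_assoc)
    then have "s * (z \<bullet> z) \<ge> 0" by simp
    moreover have "z \<bullet> z > 0" using z(2) by simp
    ultimately show ?thesis by (metis mult_neg_pos not_less)
  qed
  have square: "l\<^sup>2 \<in> eig_supp M (axis a 1)" if "l \<in> eig_supp H (axis a 1)" for l
  proof -
    obtain z where z: "z \<in> eigenspace H l" "z $ a \<noteq> 0"
      using \<open>l \<in> _\<close> by (auto simp: eig_supp_axis_iff)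
    have "z \<in> eigenspace M (l\<^sup>2)"
      using eigenspace_mat_pow[OF z(1), of 2] by (simp add: eigenspace_def M_def numeral_2_eq_2)
    then show ?thesis using z(2) by (auto simp: eig_supp_axis_iff)
  qed
  have zero: "0 \<in> eig_supp M (axis a 1)"
    using square[OF assms(3)] by simp
  have even_pow: "\<exists>m>0. mat_pow H k = mat_pow M m" if "k > 0" "even k" for k
    using that mat_pow_mult_2[of H] by (auto simp: M_def elim!: evenE)
  note transfer = PST_mat_pow_transfer[OF sym rat nonneg zero assms(4)]
  show ?thesis
  proof (cases "\<exists>k>0. even k \<and> PST (mat_pow H k) a b")
    case True
    then obtain m where m: "m > 0" "PST (mat_pow M m) a b"
      using even_pow by metis
    have "PST (mat_pow H k) a b" if "k > 0" "even k" for k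
      using even_pow[OF that] transfer(2)[OF _ m] by metis
    moreover have "\<forall>l\<in>eig_supp H (axis a 1). l\<^sup>2 \<in> \<rat>"
      using transfer(1)[OF _ m] square by blast
    ultimately show ?thesis by blast
  qed blast
qed

end
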